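(* Let $G=(\vec{Q},T)$ be a reversible witness graph for a VAS $\vec{A}\subseteq\mathbb{Z}^d$, and let $q=|\vec{Q}|$ and $a=\|\vec{A}\|_\infty$. Then the zero vector is the displacement of a total Kirchhoff function $\mu$ for $G$ satisfying $$\|\mu\|_\infty\leq (q(1+2a))^{d(d+1)}.$$
   Context: Let $\star$ be a new symbol, $\mathbb{N}_\star=\mathbb{N}\cup\{\star\}$; for $I\subseteq\{1,\ldots,d\}$, $\mathbb{N}_I^d$ is the set of $\vec{c}\in\mathbb{N}_\star^d$ with $\{i\mid\vec{c}(i)=\star\}=I$. For $\vec{a}\in\mathbb{Z}^d$, $\pi_I(\vec{a})$ replaces the components in $I$ by $\star$, and addition is componentwise outside $I$. A VAS is a finite $\vec{A}\subseteq\mathbb{Z}^d$, $\|\vec{A}\|_\infty=\max_{\vec{a}\in\vec{A}}\max_i|\vec{a}(i)|$ ($0$ if empty). A subreachability graph is $G=(\vec{Q},T)$ with $\vec{Q}\subseteq\mathbb{N}_I^d$ a nonempty finite set of states and $T\subseteq\vec{Q}\times\vec{A}\times\vec{Q}$ a finite set of transitions $(\vec{x},\vec{a},\vec{y})$ with $\vec{y}=\vec{x}+\pi_I(\vec{a})$; a witness graph is a strongly connected subreachability graph. A path $\vec{x}\xrightarrow{\sigma}_G\vec{y}$ labelled by $\sigma=\vec{a}_1\cdots\vec{a}_k$ is a sequence of transitions $(\vec{c}_{j-1},\vec{a}_j,\vec{c}_j)\in T$ with $\vec{c}_0=\vec{x}$, $\vec{c}_k=\vec{y}$; $\Delta(\sigma)=\sum_j\vec{a}_j$.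 $G$ is reversible if for every path $\vec{x}\xrightarrow{u}_G\vec{y}$ there is a path $\vec{y}\xrightarrow{v}_G\vec{x}$ with $\Delta(u)+\Delta(v)=\vec{0}$. A Kirchhoff function for $G$ is $\mu:T\to\mathbb{N}$ such that at every state the sum of $\mu$ over incoming transitions equals the sum over outgoing transitions; it is total if $\mu(t)\geq1$ for all $t\in T$; its displacement is $\sum_{t=(\vec{x},\vec{a},\vec{y})\in T}\mu(t)\vec{a}$; $\|\mu\|_\infty=\max_{t\in T}\mu(t)$. *)

theory Defs
  imports "Jordan_Normal_Form.Matrix"
begin

text \<open>
  Vectors of dimension \<open>d\<close> are elements of \<open>carrier_vec d\<close>, so components are indexed by
  \<open>{0..<d}\<close> instead of \<open>{1..d}\<close>, and \<open>d = 0\<close> is allowed.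
  The extra symbol \<open>\<star>\<close> is represented by \<open>None\<close>.
\<close>

type_synonym state = "nat option vec"
type_synonym transition = "state \<times> int vec \<times> state"

definition star_vecs :: "nat \<Rightarrow> nat set \<Rightarrow> state set" where
  "star_vecs d I = {c \<in> carrier_vec d. {i. i < d \<and> c $ i = None} = I}"

definition star_proj :: "nat set \<Rightarrow> int vec \<Rightarrow> int option vec" where
  "star_proj I a = vec (dim_vec a) (\<lambda>i. if i \<in> I then None else Some (a $ i))"

definition star_plus :: "int option \<Rightarrow> int option \<Rightarrow> int option" where
  "star_plus m n = (case (m, n) of (Some k, Some l) \<Rightarrow> Some (k + l) | _ \<Rightarrow> None)"

definition star_plus_vec :: "int option vec \<Rightarrow> int option vec \<Rightarrow> int option vec" where
  "star_plus_vec u v = vec (dim_vec v) (\<lambda>i. star_plus (u $ i) (v $ i))"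

definition is_vas :: "nat \<Rightarrow> int vec set \<Rightarrow> bool" where
  "is_vas d A \<longleftrightarrow> finite A \<and> A \<subseteq> carrier_vec d"

text \<open>
  All entries are nonnegative, so inserting \<open>0\<close> only fixes the value to be \<open>0\<close>
  when \<open>A\<close> is empty or \<open>d = 0\<close>; the same device is used for the norm of \<open>\<mu>\<close> below.
\<close>

definition vas_norm :: "nat \<Rightarrow> int vec set \<Rightarrow> nat" where
  "vas_norm d A = Max (insert 0 {nat \<bar>a $ i\<bar> | a i. a \<in> A \<and> i < d})"

text \<open>The sum \<open>x + \<pi>\<^sub>I(a)\<close> is formed over \<open>\<int> \<union> {\<star>}\<close>, into which \<open>x\<close> and \<open>y\<close> are embedded.\<close>

definition subreachability_graph ::
    "nat \<Rightarrow> int vec set \<Rightarrow> state set \<Rightarrow> transition set \<Rightarrow> bool" where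
  "subreachability_graph d A Q T \<longleftrightarrow>
     (\<exists>I \<subseteq> {..<d}.
        finite Q \<and> Q \<noteq> {} \<and> Q \<subseteq> star_vecs d I \<and>
        finite T \<and> T \<subseteq> Q \<times> A \<times> Q \<and>
        (\<forall>(x, a, y) \<in> T.
           map_vec (map_option int) y =
             star_plus_vec (map_vec (map_option int) x) (star_proj I a)))"

inductive graph_path :: "state set \<Rightarrow> transition set \<Rightarrow> state \<Rightarrow> int vec list \<Rightarrow> state \<Rightarrow> bool"
  for Q T where
  graph_path_Nil: "x \<in> Q \<Longrightarrow> graph_path Q T x [] x"
| graph_path_Cons: "(x, a, y) \<in> T \<Longrightarrow> graph_path Q T y \<sigma> z \<Longrightarrow> graph_path Q T x (a # \<sigma>) z"

definition strongly_connected :: "state set \<Rightarrow> transition set \<Rightarrow> bool" where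
  "strongly_connected Q T \<longleftrightarrow> (\<forall>x \<in> Q. \<forall>y \<in> Q. \<exists>\<sigma>. graph_path Q T x \<sigma> y)"

definition witness_graph ::
    "nat \<Rightarrow> int vec set \<Rightarrow> state set \<Rightarrow> transition set \<Rightarrow> bool" where
  "witness_graph d A Q T \<longleftrightarrow> subreachability_graph d A Q T \<and> strongly_connected Q T"

definition word_displacement :: "nat \<Rightarrow> int vec list \<Rightarrow> int vec" where
  "word_displacement d \<sigma> = foldr (+) \<sigma> (0\<^sub>v d)"

definition reversible :: "nat \<Rightarrow> state set \<Rightarrow> transition set \<Rightarrow> bool" where
  "reversible d Q T \<longleftrightarrow>
     (\<forall>x y u. graph_path Q T x u y \<longrightarrow>
        (\<exists>v. graph_path Q T y v x \<and> word_displacement d u + word_displacement d v = 0\<^sub>v d))"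

text \<open>Only the values of \<open>\<mu>\<close> on \<open>T\<close> are relevant in the following definitions.\<close>

definition kirchhoff :: "state set \<Rightarrow> transition set \<Rightarrow> (transition \<Rightarrow> nat) \<Rightarrow> bool" where
  "kirchhoff Q T \<mu> \<longleftrightarrow>
     (\<forall>c \<in> Q. (\<Sum>t \<in> {(x, a, y) \<in> T. y = c}. \<mu> t) = (\<Sum>t \<in> {(x, a, y) \<in> T. x = c}. \<mu> t))"

definition total_kirchhoff :: "state set \<Rightarrow> transition set \<Rightarrow> (transition \<Rightarrow> nat) \<Rightarrow> bool" where
  "total_kirchhoff Q T \<mu> \<longleftrightarrow> kirchhoff Q T \<mu> \<and> (\<forall>t \<in> T. 1 \<le> \<mu> t)"

definition kirchhoff_displacement :: "nat \<Rightarrow> transition set \<Rightarrow> (transition \<Rightarrow> nat) \<Rightarrow> int vec" where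
  "kirchhoff_displacement d T \<mu> =
     finsum_vec TYPE(int) d (\<lambda>t. case t of (x, a, y) \<Rightarrow> int (\<mu> t) \<cdot>\<^sub>v a) T"

definition kirchhoff_norm :: "transition set \<Rightarrow> (transition \<Rightarrow> nat) \<Rightarrow> nat" where
  "kirchhoff_norm T \<mu> = Max (insert 0 (\<mu> ` T))"

end

theory Submission
  imports Defs
begin

text \<open>
  By reversibility every transition lies in the support of a Kirchhoff function with zero
  displacement. Such a function is a sum of indicator functions of transition sets with at most
  \<open>q\<close> elements that are themselves Kirchhoff, and the displacements of these sets have entries at most
  \<open>q a\<close>. The multiplicities therefore solve a homogeneous system of \<open>d\<close> equations with
  coefficients bounded by \<open>B = q a\<close>, and some solution in natural numbers that still uses the given
  transition has sum at most \<open>(2 B + 1) ^ d\<^sup>2\<close>. Summing these small solutions over the at most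
  \<open>q (1 + 2 a) ^ d\<close> transitions gives the bound.

  A small solution is found without determinants: in a solution of minimal support that contains
  the prescribed index, the columns of the other support indices are independent. A minimal set of
  rows that still witnesses this independence has fewer elements than the support, so the
  pigeonhole principle yields a small integer solution for these rows. It is proportional to the
  given positive solution, hence of constant sign and a solution for all rows.
\<close>

section \<open>Small solutions of homogeneous linear systems\<close>

text \<open>Pigeonhole: the integer vectors with entries in \<open>{0..H}\<close> outnumber the
  points of the box containing their images, so two of them collide and their difference is a
  nonzero kernel vector. The choice \<open>H = (n * B) ^ r\<close> avoids taking integer
  roots.\<close>

lemma siegel_lemma:
  fixes m :: "'i \<Rightarrow> 'j \<Rightarrow> int" and B :: nat
  assumes fin: "finite I" "finite J" and less: "card I < card J" and B: "B \<ge> 1"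
    and bound: "\<And>i j. i \<in> I \<Longrightarrow> j \<in> J \<Longrightarrow> \<bar>m i j\<bar> \<le> int B"
  shows "\<exists>z. (\<exists>j\<in>J. z j \<noteq> 0) \<and> (\<forall>i\<in>I. (\<Sum>j\<in>J. m i j * z j) = 0) \<and>
             (\<forall>j\<in>J. \<bar>z j\<bar> \<le> int ((card J * B) ^ card I))"
proof -
  define n where "n = card J"
  define r where "r = card I"
  define H where "H = (n * B) ^ r"
  define F where "F = J \<rightarrow>\<^sub>E {0..int H}"
  \<comment> \<open>Over \<open>0 \<le> z j \<le> H\<close> each term \<open>m i j * z j\<close>
    stays in an interval starting at \<open>min 0 (m i j) * H\<close> of length at most
    \<open>B * H\<close>. Hence each row takes values in an interval of length
    \<open>n * B * H\<close> starting at \<open>lo i\<close>.\<close>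
  define lo where "lo i = (\<Sum>j\<in>J. min 0 (m i j) * int H)" for i
  define G where "G = (\<Pi>\<^sub>E i\<in>I. {lo i..lo i + int (n * B * H)})"
  define \<phi> where "\<phi> z = (\<lambda>i\<in>I. \<Sum>j\<in>J. m i j * z j)" for z
  have "n \<ge> 1" using less by (simp add: n_def)
  then have nB: "n * B \<ge> 1" using B by simp
  have cardF: "card F = (H + 1) ^ n"
    using fin by (simp add: F_def card_PiE n_def nat_add_distrib)
  have cardG: "card G = (n * B * H + 1) ^ r"
    using fin by (simp add: G_def card_PiE r_def nat_add_distrib del: of_nat_mult)
  have finG: "finite G" unfolding G_def using fin by (intro finite_PiE) auto
  have sub: "\<phi> ` F \<subseteq> G"
  proof (rule image_subsetI)
    fix z assume z: "z \<in> F"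
    have zj: "0 \<le> z j \<and> z j \<le> int H" if "j \<in> J" for j
      using z that by (auto simp: F_def PiE_def Pi_def)
    have "lo i \<le> (\<Sum>j\<in>J. m i j * z j)" for i
      unfolding lo_def
    proof (rule sum_mono)
      fix j assume "j \<in> J"
      show "min 0 (m i j) * int H \<le> m i j * z j"
        using zj[OF \<open>j \<in> J\<close>] by (cases "m i j \<ge> 0") (auto simp: min_def mult_left_mono_neg)
    qed
    moreover have "(\<Sum>j\<in>J. m i j * z j) \<le> lo i + int (n * B * H)" if "i \<in> I" for i
    proof -
      have "(\<Sum>j\<in>J. m i j * z j) \<le> (\<Sum>j\<in>J. min 0 (m i j) * int H + int B * int H)"
      proof (rule sum_mono)
        fix j assume j: "j \<in> J"
        have b: "\<bar>m i j\<bar> \<le> int B" using bound that j by simp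
        show "m i j * z j \<le> min 0 (m i j) * int H + int B * int H"
        proof (cases "m i j \<ge> 0")
          case True
          then have "m i j * z j \<le> int B * int H" using b zj[OF j] by (intro mult_mono) auto
          then show ?thesis using True by simp
        next
          case False
          then have "m i j * z j \<le> 0" using zj[OF j] by (simp add: mult_nonpos_nonneg)
          also have "0 \<le> (m i j + int B) * int H" using b by (intro mult_nonneg_nonneg) auto
          finally show ?thesis using False by (simp add: min_def algebra_simps)
        qed
      qed
      also have "\<dots> = lo i + int (n * B * H)"
        by (simp add: lo_def sum.distrib n_def)
      finally show ?thesis .
    qed
    ultimately show "\<phi> z \<in> G" by (auto simp: G_def \<phi>_def)
  qed
  \<comment> \<open>As \<open>(n * B) ^ r\<close> is \<open>H\<close> itself, the right-hand side
    equals \<open>H * (H + 1) ^ r\<close>, just below \<open>(H + 1) ^ (r + 1)\<close>.\<close>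
  have "(n * B * H + 1) ^ r \<le> (n * B * (H + 1)) ^ r"
    using nB by (intro power_mono) auto
  also have "\<dots> = H * (H + 1) ^ r" unfolding H_def by (rule power_mult_distrib)
  also have "\<dots> < (H + 1) * (H + 1) ^ r" by simp
  also have "\<dots> = (H + 1) ^ Suc r" by simp
  also have "\<dots> \<le> (H + 1) ^ n" using less by (intro power_increasing) (auto simp: n_def r_def)
  finally have "card G < card F" using cardF cardG by simp
  then have "card (\<phi> ` F) < card F" using card_mono[OF finG sub] by simp
  then have "\<not> inj_on \<phi> F" by (rule pigeonhole)
  then obtain u v where uv: "u \<in> F" "v \<in> F" "u \<noteq> v" "\<phi> u = \<phi> v" by (auto simp: inj_on_def)
  have "\<exists>j\<in>J. u j - v j \<noteq> 0"
    using uv by (metis F_def PiE_ext right_minus_eq)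
  moreover have "(\<Sum>j\<in>J. m i j * (u j - v j)) = 0" if "i \<in> I" for i
    using fun_cong[OF uv(4), of i] that by (simp add: \<phi>_def right_diff_distrib sum_subtractf)
  moreover have "\<bar>u j - v j\<bar> \<le> int H" if "j \<in> J" for j
  proof -
    have "u j \<in> {0..int H}" "v j \<in> {0..int H}" using uv that by (auto simp: F_def)
    then show ?thesis by auto
  qed
  ultimately show ?thesis unfolding H_def n_def r_def
    by (intro exI[of _ "\<lambda>j. u j - v j"]) auto
qed

text \<open>A finite integer matrix has a common bound on its entries; the \<open>+ 1\<close> in
  \<open>B\<close> supplies \<open>B \<ge> 1\<close>, as \<open>siegel_lemma\<close>
  demands.\<close>

corollary homogeneous_system_nontrivial:
  fixes m :: "'i \<Rightarrow> 'j \<Rightarrow> int"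
  assumes "finite I" "finite J" "card I < card J"
  shows "\<exists>z. (\<exists>j\<in>J. z j \<noteq> 0) \<and> (\<forall>i\<in>I. (\<Sum>j\<in>J. m i j * z j) = 0)"
proof -
  define B where "B = nat (\<Sum>i\<in>I. \<Sum>j\<in>J. \<bar>m i j\<bar>) + 1"
  have "\<bar>m i j\<bar> \<le> int B" if "i \<in> I" "j \<in> J" for i j
  proof -
    have "\<bar>m i j\<bar> \<le> (\<Sum>j\<in>J. \<bar>m i j\<bar>)" using that assms by (intro member_le_sum) auto
    also have "\<dots> \<le> (\<Sum>i\<in>I. \<Sum>j\<in>J. \<bar>m i j\<bar>)"
      using that assms by (intro member_le_sum[of i]) (auto intro: sum_nonneg)
    moreover have "(\<Sum>i\<in>I. \<Sum>j\<in>J. \<bar>m i j\<bar>) \<ge> 0" by (intro sum_nonneg) auto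
    ultimately show ?thesis by (simp add: B_def)
  qed
  then show ?thesis using siegel_lemma[of I J B m] assms by (auto simp: B_def)
qed

section \<open>Minimal systems of rows and solutions of small support\<close>

lemma minimal_subset_exists:
  assumes "finite A" "P A"
  obtains R where "R \<subseteq> A" "P R" "\<And>R'. R' \<subset> R \<Longrightarrow> \<not> P R'"
  using assms
proof (induction A arbitrary: thesis rule: finite_psubset_induct)
  case (psubset A)
  show ?case
  proof (cases "\<exists>R \<subset> A. P R")
    case True
    then obtain R where "R \<subset> A" "P R" by blast
    then show ?thesis using psubset.IH[of R] psubset.prems(1) by (metis order.trans psubset_imp_subset)
  next
    case False
    then show ?thesis using psubset.prems by blast
  qed
qed

text \<open>By minimality, dropping row \<open>i\<close> admits a nonzero \<open>w i\<close> that
  all rows of \<open>R\<close> except \<open>i\<close> annihilate. These vectors are linearly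
  independent in a space of dimension \<open>card S\<close>, so there are at most that many.\<close>

lemma card_independent_rows_le:
  fixes m :: "'i \<Rightarrow> 'j \<Rightarrow> int"
  defines "P \<equiv> \<lambda>R S. \<forall>z. (\<forall>i\<in>R. (\<Sum>j\<in>S. m i j * z j) = 0) \<longrightarrow> (\<forall>j\<in>S. z j = 0)"
  assumes fin: "finite R" "finite S" and P: "P R S" and minimal: "\<And>R'. R' \<subset> R \<Longrightarrow> \<not> P R' S"
  shows "card R \<le> card S"
proof (rule ccontr)
  assume "\<not> card R \<le> card S"
  then have less: "card S < card R" by simp
  have "\<exists>z. (\<forall>k\<in>R - {i}. (\<Sum>j\<in>S. m k j * z j) = 0) \<and> (\<exists>j\<in>S. z j \<noteq> 0)" if "i \<in> R" for i
    using minimal[of "R - {i}"] that unfolding P_def by blast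
  then obtain w where w: "\<And>i k. i \<in> R \<Longrightarrow> k \<in> R - {i} \<Longrightarrow> (\<Sum>j\<in>S. m k j * w i j) = 0"
    "\<And>i. i \<in> R \<Longrightarrow> \<exists>j\<in>S. w i j \<noteq> 0"
    by metis
  have diag: "(\<Sum>j\<in>S. m i j * w i j) \<noteq> 0" if "i \<in> R" for i
    using P w that unfolding P_def by (metis insertE insert_Diff)
  obtain c where c: "\<exists>i\<in>R. c i \<noteq> 0" "\<And>j. j \<in> S \<Longrightarrow> (\<Sum>i\<in>R. w i j * c i) = 0"
    using homogeneous_system_nontrivial[OF fin(2,1) less, of "\<lambda>j i. w i j"] by auto
  then obtain i where i: "i \<in> R" "c i \<noteq> 0" by blast
  \<comment> \<open>Applying row \<open>i\<close> to the dependency among the \<open>w k\<close>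
    kills every term except that of \<open>w i\<close>.\<close>
  have "0 = (\<Sum>j\<in>S. m i j * (\<Sum>k\<in>R. w k j * c k))" using c by simp
  also have "\<dots> = (\<Sum>k\<in>R. (\<Sum>j\<in>S. m i j * w k j) * c k)"
    by (simp add: sum_distrib_left sum_distrib_right mult.assoc) (rule sum.swap)
  also have "\<dots> = (\<Sum>k\<in>R. if k = i then (\<Sum>j\<in>S. m i j * w i j) * c i else 0)"
    using w(1) i by (intro sum.cong) auto
  also have "\<dots> = (\<Sum>j\<in>S. m i j * w i j) * c i" using i fin by simp
  finally show False using diag i by simp
qed

text \<open>Induction on the support size of \<open>x\<close>. If the support columns other than
  \<open>t\<close> are dependent, the dependency removes a support index and keeps \<open>t\<close>.
  Otherwise the solutions on the support are the multiples of \<open>x\<close>, and the solution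
  from \<open>siegel_lemma\<close> becomes nonnegative after a change of sign. There are then at
  most \<open>card I + 1\<close> nonzero entries.\<close>

lemma small_solution_siegel:
  fixes m :: "'i \<Rightarrow> 'j \<Rightarrow> int" and x :: "'j \<Rightarrow> nat" and B :: nat
  assumes fin: "finite I" "finite J" and t: "t \<in> J" and B: "B \<ge> 1"
    and bound: "\<And>i j. i \<in> I \<Longrightarrow> j \<in> J \<Longrightarrow> \<bar>m i j\<bar> \<le> int B"
    and "x t \<ge> 1" and "\<And>i. i \<in> I \<Longrightarrow> (\<Sum>j\<in>J. m i j * int (x j)) = 0"
  shows "\<exists>y::'j \<Rightarrow> nat. y t \<ge> 1 \<and> (\<forall>i\<in>I. (\<Sum>j\<in>J. m i j * int (y j)) = 0) \<and>
           (\<Sum>j\<in>J. y j) \<le> (card I + 1) * ((card I + 1) * B) ^ card I"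
  using assms(6,7)
proof (induction "card {j\<in>J. x j > 0}" arbitrary: x rule: less_induct)
  case less
  define S where "S = {j\<in>J. x j > 0}"
  \<comment> \<open>Index \<open>t\<close> is set apart so that a dependency among the columns in
    \<open>S'\<close>, extended by \<open>0\<close>, leaves the entry at \<open>t\<close>
    positive.\<close>
  define S' where "S' = S - {t}"
  have S: "finite S" "S \<subseteq> J" "t \<in> S" "finite S'" "S' \<subseteq> S" "S = insert t S'" "t \<notin> S'"
    using fin t less.prems(1) by (auto simp: S_def S'_def)
  have cS: "card S = card S' + 1" using S by simp
  have extend: "(\<Sum>j\<in>S. f j) = (\<Sum>j\<in>J. f j)" if "\<And>j. j \<notin> S \<Longrightarrow> f j = 0" for f :: "'j \<Rightarrow> int"
    using S fin that by (intro sum.mono_neutral_left) auto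
  have kerx: "(\<Sum>j\<in>S. m i j * int (x j)) = 0" if "i \<in> I" for i
  proof -
    have "(\<Sum>j\<in>S. m i j * int (x j)) = (\<Sum>j\<in>J. m i j * int (x j))"
      using fin by (intro sum.mono_neutral_left) (auto simp: S_def)
    then show ?thesis using less.prems(2)[OF that] by simp
  qed
  define P where "P R \<longleftrightarrow> (\<forall>z. (\<forall>i\<in>R. (\<Sum>j\<in>S'. m i j * z j) = 0) \<longrightarrow> (\<forall>j\<in>S'. z j = 0))" for R
  show ?case
  proof (cases "P I")
    case False
    then obtain z0 where z0: "\<forall>i\<in>I. (\<Sum>j\<in>S'. m i j * z0 j) = 0" "\<exists>j\<in>S'. z0 j \<noteq> 0"
      unfolding P_def by blast
    \<comment> \<open>The ratio test needs a positive coordinate; if \<open>z0\<close> has none, its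
      negative has one.\<close>
    have "\<exists>z. (\<forall>i\<in>I. (\<Sum>j\<in>S'. m i j * z j) = 0) \<and> (\<exists>j\<in>S'. z j > 0)"
    proof (cases "\<exists>j\<in>S'. z0 j > 0")
      case True then show ?thesis using z0 by blast
    next
      case False
      then have "\<exists>j\<in>S'. - z0 j > 0" using z0(2) by force
      moreover have "\<forall>i\<in>I. (\<Sum>j\<in>S'. m i j * - z0 j) = 0" using z0(1) by (simp add: sum_negf)
      ultimately show ?thesis by (intro exI[of _ "\<lambda>j. - z0 j"]) blast
    qed
    then obtain z1 where z1: "\<forall>i\<in>I. (\<Sum>j\<in>S'. m i j * z1 j) = 0" "\<exists>j\<in>S'. z1 j > 0" by blast
    define z where "z j = (if j \<in> S' then z1 j else 0)" for j
    have kerz: "(\<Sum>j\<in>J. m i j * z j) = 0" if "i \<in> I" for i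
    proof -
      have "(\<Sum>j\<in>J. m i j * z j) = (\<Sum>j\<in>S'. m i j * z j)"
        using fin S by (intro sum.mono_neutral_right) (auto simp: z_def)
      also have "\<dots> = (\<Sum>j\<in>S'. m i j * z1 j)" by (intro sum.cong) (auto simp: z_def)
      finally show ?thesis using z1 that by simp
    qed
    txt \<open>Moving from \<open>x\<close> in direction \<open>- z\<close> until a coordinate vanishes; the ratio test selects it.\<close>
    define r where "r j = of_nat (x j) / (of_int (z j) :: rat)" for j
    define K where "K = {j\<in>S'. z j > 0}"
    have K: "finite K" "K \<noteq> {}" using S z1 by (auto simp: K_def z_def)
    define p where "p = arg_min_on r K"
    have p: "p \<in> K" "\<And>j. j \<in> K \<Longrightarrow> r p \<le> r j"
      using arg_min_if_finite(1)[OF K, of r] arg_min_least[OF K, of _ r] by (auto simp: p_def)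
    have zp: "z p > 0" "p \<in> S'" using p by (auto simp: K_def)
    have nonneg: "z p * int (x j) - int (x p) * z j \<ge> 0" for j
    proof (cases "z j > 0")
      case True
      then have "j \<in> K" by (auto simp: K_def z_def split: if_splits)
      then have "r p \<le> r j" by (rule p)
      then have "of_nat (x p) * of_int (z j) \<le> (of_nat (x j) * of_int (z p) :: rat)"
        using True zp by (simp add: r_def field_simps)
      then have "(of_int (int (x p) * z j) :: rat) \<le> of_int (int (x j) * z p)" by simp
      then have "int (x p) * z j \<le> int (x j) * z p" by (simp only: of_int_le_iff)
      then show ?thesis by (simp add: mult.commute)
    next
      case False
      have "int (x p) * z j \<le> 0" using False by (simp add: mult_nonneg_nonpos)
      moreover have "z p * int (x j) \<ge> 0" using zp by simp
      ultimately show ?thesis by linarith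
    qed
    \<comment> \<open>This is \<open>x - (x p / z p) z\<close>, scaled by \<open>z p > 0\<close> to
      stay integral. It vanishes at \<open>p\<close> and equals \<open>z p * x t\<close> at
      \<open>t\<close>.\<close>
    define x' where "x' j = nat (z p * int (x j) - int (x p) * z j)" for j
    have x': "int (x' j) = z p * int (x j) - int (x p) * z j" for j
      using nonneg[of j] by (simp add: x'_def)
    have "z t = 0" using S by (simp add: z_def)
    then have "int (x' t) > 0" using zp less.prems(1) by (simp add: x')
    then have xt: "x' t \<ge> 1" by simp
    have "(\<Sum>j\<in>J. m i j * int (x' j)) = 0" if "i \<in> I" for i
    proof -
      have "(\<Sum>j\<in>J. m i j * int (x' j))
        = z p * (\<Sum>j\<in>J. m i j * int (x j)) - int (x p) * (\<Sum>j\<in>J. m i j * z j)"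
        unfolding x' by (simp add: sum_distrib_left sum_subtractf[symmetric] algebra_simps)
      then show ?thesis using kerz less.prems(2) that by simp
    qed
    moreover have "card {j\<in>J. x' j > 0} < card {j\<in>J. x j > 0}"
    proof (rule psubset_card_mono)
      have "x' j = 0" if "x j = 0" "j \<in> J" for j
      proof -
        have "j \<notin> S'" using that by (auto simp: S_def S'_def)
        then show ?thesis using that by (simp add: x'_def z_def)
      qed
      then have "{j\<in>J. x' j > 0} \<subseteq> {j\<in>J. x j > 0}" by (auto intro!: gr0I)
      moreover have "p \<notin> {j\<in>J. x' j > 0}" by (simp add: x'_def mult.commute)
      moreover have "p \<in> {j\<in>J. x j > 0}" using zp S by (auto simp: S'_def S_def)
      ultimately show "{j\<in>J. x' j > 0} \<subset> {j\<in>J. x j > 0}" by blast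
    qed (use fin in simp)
    ultimately show ?thesis using less.hyps[of x'] xt by blast
  next
    case True
    obtain R where R: "R \<subseteq> I" "P R" "\<And>R'. R' \<subset> R \<Longrightarrow> \<not> P R'"
      using minimal_subset_exists[of I P] fin True by blast
    have finR: "finite R" using R fin finite_subset by blast
    txt \<open>Rows in \<open>R\<close> suffice: a solution \<open>z\<close> of these rows supported on \<open>S\<close> must be a multiple of \<open>x\<close>,
      as \<open>x t * z - z t * x\<close> vanishes at \<open>t\<close>.\<close>
    have "card R \<le> card S'"
      using card_independent_rows_le[of R S' m] R finR S by (simp add: P_def)
    \<comment> \<open>The index \<open>t\<close> contributes the extra column that makes the
      inequality strict, as \<open>siegel_lemma\<close> requires.\<close>
    then have cR: "card R < card S" using cS by simp
    \<comment> \<open>Independent columns cannot outnumber the rows; this bounds the support by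
      \<open>card I + 1\<close> in the final estimate.\<close>
    have cS': "card S' \<le> card I"
    proof (rule ccontr)
      assume "\<not> ?thesis"
      then show False using homogeneous_system_nontrivial[of I S' m] fin S True unfolding P_def by auto
    qed
    have cRI: "card R \<le> card I" using R fin card_mono by blast
    have bnd: "\<bar>m i j\<bar> \<le> int B" if "i \<in> R" "j \<in> S" for i j
      using bound that R S by blast
    obtain z where z: "\<exists>j\<in>S. z j \<noteq> 0" "\<And>i. i \<in> R \<Longrightarrow> (\<Sum>j\<in>S. m i j * z j) = 0"
      "\<And>j. j \<in> S \<Longrightarrow> \<bar>z j\<bar> \<le> int ((card S * B) ^ card R)"
    proof -
      have "\<exists>z. (\<exists>j\<in>S. z j \<noteq> 0) \<and> (\<forall>i\<in>R. (\<Sum>j\<in>S. m i j * z j) = 0) \<and>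
        (\<forall>j\<in>S. \<bar>z j\<bar> \<le> int ((card S * B) ^ card R))"
        by (rule siegel_lemma[OF finR S(1) cR B]) (rule bnd)
      then show thesis using that by blast
    qed
    have proportional: "int (x t) * z j = z t * int (x j)" if "j \<in> S" for j
    proof -
      define w where "w j = int (x t) * z j - z t * int (x j)" for j
      have wt: "w t = 0" by (simp add: w_def mult.commute)
      have "(\<Sum>j\<in>S'. m i j * w j) = 0" if "i \<in> R" for i
      proof -
        have "(\<Sum>j\<in>S'. m i j * w j) = (\<Sum>j\<in>S. m i j * w j)"
          using S wt by simp
        also have "\<dots> = int (x t) * (\<Sum>j\<in>S. m i j * z j) - z t * (\<Sum>j\<in>S. m i j * int (x j))"
          by (simp add: w_def sum_distrib_left sum_subtractf[symmetric] algebra_simps)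
        finally show ?thesis using z(2) kerx that R by auto
      qed
      then have "\<forall>j\<in>S'. w j = 0" using R(2) unfolding P_def by blast
      then have "w j = 0" using that wt S by auto
      then show ?thesis by (simp add: w_def)
    qed
    have xt: "x t > 0" using less.prems by simp
    have zt: "z t \<noteq> 0"
    proof
      assume "z t = 0"
      then have "z j = 0" if "j \<in> S" for j using proportional[OF that] xt by simp
      then show False using z(1) by blast
    qed
    \<comment> \<open>Since \<open>z\<close> is a multiple of the vector \<open>x\<close>, which is
      positive on \<open>S\<close>, all its entries there share the sign of
      \<open>z t\<close>.\<close>
    have absz: "\<bar>z j\<bar> = sgn (z t) * z j" if "j \<in> S" for j
    proof -
      have "x j > 0" using that by (simp add: S_def)
      have "int (x t) * \<bar>z j\<bar> = \<bar>int (x t) * z j\<bar>" by (simp add: abs_mult)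
      also have "\<dots> = \<bar>z t\<bar> * int (x j)" using proportional[OF that] by (simp add: abs_mult)
      also have "\<dots> = sgn (z t) * (z t * int (x j))" by (simp add: abs_sgn mult.commute)
      also have "\<dots> = int (x t) * (sgn (z t) * z j)" using proportional[OF that] by simp
      finally show ?thesis using xt by simp
    qed
    define y where "y j = (if j \<in> S then nat \<bar>z j\<bar> else 0)" for j
    have "(\<Sum>j\<in>J. m i j * int (y j)) = 0" if "i \<in> I" for i
    proof -
      have "(\<Sum>j\<in>J. m i j * int (y j)) = (\<Sum>j\<in>S. m i j * int (y j))"
        by (rule extend[symmetric]) (simp add: y_def)
      also have "\<dots> = (\<Sum>j\<in>S. sgn (z t) * (m i j * z j))"
      proof (rule sum.cong)
        fix j assume j: "j \<in> S"
        then have "int (y j) = sgn (z t) * z j" unfolding absz[OF j, symmetric] by (simp add: y_def)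
        then show "m i j * int (y j) = sgn (z t) * (m i j * z j)" by simp
      qed simp
      also have "\<dots> = sgn (z t) * (\<Sum>j\<in>S. m i j * z j)" by (simp add: sum_distrib_left)
      finally have *: "(\<Sum>j\<in>J. m i j * int (y j)) = sgn (z t) * (\<Sum>j\<in>S. m i j * z j)" .
      \<comment> \<open>\<open>siegel_lemma\<close> only handled the rows in \<open>R\<close>. For
        any row of \<open>I\<close>, proportionality transfers the equation from \<open>x\<close> to
        \<open>z\<close>.\<close>
      have "int (x t) * (\<Sum>j\<in>S. m i j * z j) = (\<Sum>j\<in>S. m i j * (int (x t) * z j))"
        by (simp add: sum_distrib_left algebra_simps)
      also have "\<dots> = (\<Sum>j\<in>S. m i j * (z t * int (x j)))"
        using proportional by (intro sum.cong) auto
      also have "\<dots> = z t * (\<Sum>j\<in>S. m i j * int (x j))"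
        by (simp add: sum_distrib_left algebra_simps)
      finally show ?thesis using * kerx[OF that] xt by simp
    qed
    moreover have "y t \<ge> 1" using zt S by (simp add: y_def)
    moreover have "(\<Sum>j\<in>J. y j) \<le> (card I + 1) * ((card I + 1) * B) ^ card I"
    proof -
      have "(\<Sum>j\<in>J. y j) = (\<Sum>j\<in>S. y j)"
        using fin S by (intro sum.mono_neutral_right) (auto simp: y_def)
      also have "\<dots> \<le> card S * (card S * B) ^ card R"
      proof -
        have "y j \<le> (card S * B) ^ card R" if "j \<in> S" for j
          using z(3)[OF that] that by (simp add: y_def nat_le_iff)
        then show ?thesis using sum_bounded_above[of S y] by simp
      qed
      also have "\<dots> \<le> (card I + 1) * ((card I + 1) * B) ^ card R"
        using cS cS' by (intro mult_mono power_mono) auto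
      also have "\<dots> \<le> (card I + 1) * ((card I + 1) * B) ^ card I"
        using cRI B by (intro mult_left_mono power_increasing) auto
      finally show ?thesis .
    qed
    ultimately show ?thesis by blast
  qed
qed


text \<open>The bound of \<open>small_solution_siegel\<close> exceeds \<open>2 * B + 1\<close> when there is a single row.\<close>

lemma small_solution_single_row:
  fixes m :: "'j \<Rightarrow> int" and x :: "'j \<Rightarrow> nat" and B :: nat
  assumes fin: "finite J" and t: "t \<in> J" and B: "B \<ge> 1"
    and bound: "\<And>j. j \<in> J \<Longrightarrow> \<bar>m j\<bar> \<le> int B"
    and x: "x t \<ge> 1" "(\<Sum>j\<in>J. m j * int (x j)) = 0"
  shows "\<exists>y::'j \<Rightarrow> nat. y t \<ge> 1 \<and> (\<Sum>j\<in>J. m j * int (y j)) = 0 \<and> (\<Sum>j\<in>J. y j) \<le> 2 * B"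
proof (cases "m t = 0")
  case True
  define y where "y j = (if j = t then 1 else 0 :: nat)" for j
  have "m j * int (y j) = 0" for j using True by (simp add: y_def)
  then have "(\<Sum>j\<in>J. m j * int (y j)) = 0" by (simp only: sum.neutral_const)
  moreover have "(\<Sum>j\<in>J. y j) = 1" using fin t by (simp add: y_def)
  moreover have "y t \<ge> 1" by (simp add: y_def)
  ultimately show ?thesis using B by (intro exI[of _ y]) simp
next
  case False
  \<comment> \<open>The term at \<open>t\<close> is nonzero in a sum that vanishes with nonnegative
    weights, so some coefficient has the opposite sign.\<close>
  have "\<exists>k\<in>J. m k * m t < 0"
  proof (rule ccontr)
    assume "\<not> ?thesis"
    then have nn: "0 \<le> m j * m t" if "j \<in> J" for j using that by force
    have "0 < (m t)\<^sup>2 * int (x t)" using False x(1) by simp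
    then have "0 < m t * m t * int (x t)" by (simp only: power2_eq_square)
    also have "\<dots> \<le> (\<Sum>j\<in>J. m j * m t * int (x j))"
      using fin t nn by (intro member_le_sum) auto
    also have "\<dots> = m t * (\<Sum>j\<in>J. m j * int (x j))" by (simp add: sum_distrib_left algebra_simps)
    finally show False using x(2) by simp
  qed
  then obtain k where k: "k \<in> J" "m k * m t < 0" by blast
  then have kt: "k \<noteq> t" by (metis not_square_less_zero)
  \<comment> \<open>Weights \<open>\<bar>m k\<bar>\<close> at \<open>t\<close> and
    \<open>\<bar>m t\<bar>\<close> at \<open>k\<close> cancel, as \<open>m t\<close> and
    \<open>m k\<close> have opposite signs; each is at most \<open>B\<close>.\<close>
  define y where "y j = (if j = t then nat \<bar>m k\<bar> else if j = k then nat \<bar>m t\<bar> else 0)" for j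
  have two: "(\<Sum>j\<in>J. f j) = f t + f k" if "\<And>j. y j = 0 \<Longrightarrow> f j = 0" for f :: "'j \<Rightarrow> 'b::comm_monoid_add"
  proof -
    have "(\<Sum>j\<in>J. f j) = (\<Sum>j\<in>{t, k}. f j)"
      using fin t k that by (intro sum.mono_neutral_right) (auto simp: y_def)
    then show ?thesis using kt by simp
  qed
  have "(\<Sum>j\<in>J. m j * int (y j)) = m t * \<bar>m k\<bar> + m k * \<bar>m t\<bar>"
    using kt by (subst two) (auto simp: y_def)
  also have "\<dots> = 0" using k(2) by (auto simp: mult_less_0_iff)
  finally have "(\<Sum>j\<in>J. m j * int (y j)) = 0" .
  moreover have "(\<Sum>j\<in>J. y j) \<le> 2 * B"
    using kt bound[OF t] bound[OF k(1)] by (subst two) (auto simp: y_def)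
  moreover have "y t \<ge> 1" using k(2) by (auto simp: y_def Suc_le_eq)
  ultimately show ?thesis by blast
qed

text \<open>Split the exponent as \<open>d + d * (d - 1)\<close> and bound \<open>2 * B + 1\<close>
  below by \<open>2 * B\<close> in the first part and by \<open>3\<close> in the second. The factor
  \<open>B ^ d\<close> cancels, leaving a numerical inequality in \<open>d\<close>. For
  \<open>d = 1\<close> the claim would read \<open>4 * B \<le> 2 * B + 1\<close>, which is
  false.\<close>

lemma siegel_bound_le:
  assumes "d \<ge> 2" "B \<ge> (1::nat)"
  shows "(d + 1) * ((d + 1) * B) ^ d \<le> (2 * B + 1) ^ d\<^sup>2"
proof -
  have *: "(d + 1) ^ (d + 1) \<le> 2 ^ d * (3::nat) ^ (d * (d - 1))"
    using assms(1)
  proof (induction d rule: dec_induct)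
    case base
    then show ?case by simp
  next
    case (step d)
    \<comment> \<open>With \<open>d + 2 \<le> 2 * (d + 1)\<close> the left side grows by at most
      \<open>2 ^ (d + 1) * (d + 2)\<close>, while the right side gains
      \<open>2 * 3 ^ (2 * d)\<close>.\<close>
    have "(d + 2) ^ (d + 2) \<le> (2 * (d + 1)) ^ (d + 1) * (d + 2)"
    proof -
      have "(d + 2) ^ (d + 1) \<le> (2 * (d + 1)) ^ (d + 1)" by (intro power_mono) auto
      then have "(d + 2) ^ (d + 1) * (d + 2) \<le> (2 * (d + 1)) ^ (d + 1) * (d + 2)"
        by (rule mult_right_mono) simp
      then show ?thesis by (simp add: mult.commute)
    qed
    also have "\<dots> = (d + 1) ^ (d + 1) * (2 ^ (d + 1) * (d + 2))"
      by (simp only: power_mult_distrib mult_ac)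
    also have "\<dots> \<le> (2 ^ d * 3 ^ (d * (d - 1))) * (2 * 3 ^ (2 * d))"
    proof (rule mult_mono[OF step.IH])
      have "d + 2 \<le> 2 ^ d" using step.hyps
        by (induction d rule: dec_induct) auto
      then have "2 ^ (d + 1) * (d + 2) \<le> 2 * (2 ^ d * 2 ^ d)" by (simp del: add_2_eq_Suc' add: mult_left_mono)
      also have "(2::nat) ^ d * 2 ^ d \<le> 3 ^ d * 3 ^ d" by (intro mult_mono power_mono) auto
      finally show "2 ^ (d + 1) * (d + 2) \<le> 2 * 3 ^ (2 * d)" by (simp add: mult_2 power_add)
    qed auto
    also have "\<dots> = 2 ^ Suc d * 3 ^ (d * (d - 1) + 2 * d)" by (simp add: power_add)
    also have "d * (d - 1) + 2 * d = Suc d * (Suc d - 1)"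
      using step.hyps by (cases d) auto
    finally have "(d + 2) ^ (d + 2) \<le> 2 ^ Suc d * 3 ^ (Suc d * (Suc d - 1))" .
    moreover have "Suc d + 1 = d + 2" by simp
    ultimately show ?case by (simp only:)
  qed
  have "(d + 1) * ((d + 1) * B) ^ d = (d + 1) ^ (d + 1) * B ^ d"
    by (simp only: power_mult_distrib power_add power_one_right mult_ac)
  also have "\<dots> \<le> 2 ^ d * 3 ^ (d * (d - 1)) * B ^ d"
    using * by (rule mult_right_mono) simp
  also have "\<dots> = (2 * B) ^ d * 3 ^ (d * (d - 1))" by (simp add: power_mult_distrib)
  also have "\<dots> \<le> (2 * B + 1) ^ d * (2 * B + 1) ^ (d * (d - 1))"
    using assms(2) by (intro mult_mono power_mono) auto
  also have "\<dots> = (2 * B + 1) ^ (d + d * (d - 1))" by (simp add: power_add)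
  also have "d + d * (d - 1) = d\<^sup>2" using assms(1) by (cases d) (auto simp: power2_eq_square)
  finally show ?thesis .
qed

text \<open>One row is treated by \<open>small_solution_single_row\<close>, more rows by
  \<open>small_solution_siegel\<close> with \<open>siegel_bound_le\<close>. The quadratic exponent
  leaves one further factor of exponent \<open>d\<close> in the final bound for counting
  transitions.\<close>

lemma small_solution:
  fixes m :: "'i \<Rightarrow> 'j \<Rightarrow> int" and x :: "'j \<Rightarrow> nat" and B :: nat
  assumes fin: "finite I" "finite J" and I: "card I \<ge> 1" and t: "t \<in> J" and B: "B \<ge> 1"
    and bound: "\<And>i j. i \<in> I \<Longrightarrow> j \<in> J \<Longrightarrow> \<bar>m i j\<bar> \<le> int B"
    and x: "x t \<ge> 1" "\<And>i. i \<in> I \<Longrightarrow> (\<Sum>j\<in>J. m i j * int (x j)) = 0"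
  shows "\<exists>y::'j \<Rightarrow> nat. y t \<ge> 1 \<and> (\<forall>i\<in>I. (\<Sum>j\<in>J. m i j * int (y j)) = 0) \<and>
           (\<Sum>j\<in>J. y j) \<le> (2 * B + 1) ^ (card I)\<^sup>2"
proof (cases "card I = 1")
  case True
  then obtain i where i: "I = {i}" by (rule card_1_singletonE)
  show ?thesis
    using small_solution_single_row[OF fin(2) t B, of "m i" x] bound x by (force simp: i)
next
  case False
  then have "card I \<ge> 2" using I by simp
  then have "(card I + 1) * ((card I + 1) * B) ^ card I \<le> (2 * B + 1) ^ (card I)\<^sup>2"
    using B by (rule siegel_bound_le)
  moreover have "\<exists>y. y t \<ge> 1 \<and> (\<forall>i\<in>I. (\<Sum>j\<in>J. m i j * int (y j)) = 0) \<and>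
      (\<Sum>j\<in>J. y j) \<le> (card I + 1) * ((card I + 1) * B) ^ card I"
    using bound x by (intro small_solution_siegel[OF fin t B]) auto
  ultimately show ?thesis by (meson order_trans)
qed

section \<open>Decomposition of circulations\<close>

text \<open>Conservation is asked at every value of the vertex type, and incidence enters as a 0/1
  weight, so that both sides are linear in \<open>f\<close> over the fixed index set
  \<open>T\<close>.\<close>

definition balanced :: "'e set \<Rightarrow> ('e \<Rightarrow> 'v) \<Rightarrow> ('e \<Rightarrow> 'v) \<Rightarrow> ('e \<Rightarrow> nat) \<Rightarrow> bool" where
  "balanced T src tgt f \<longleftrightarrow>
     (\<forall>c. (\<Sum>t\<in>T. f t * of_bool (tgt t = c)) = (\<Sum>t\<in>T. f t * of_bool (src t = c)))"

text \<open>These sets play the role of simple cycles: a simple cycle leaves each vertex at most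
  once, hence the size bound. Connectedness is not asked for.\<close>

definition circulations :: "'e set \<Rightarrow> ('e \<Rightarrow> 'v) \<Rightarrow> ('e \<Rightarrow> 'v) \<Rightarrow> 'e set set" where
  "circulations T src tgt =
     {C. C \<subseteq> T \<and> card C \<le> card (src ` T) \<and> balanced T src tgt (\<lambda>t. of_bool (t \<in> C))}"

lemma balanced_sum:
  assumes "\<And>k. k \<in> K \<Longrightarrow> balanced T src tgt (f k)"
  shows "balanced T src tgt (\<lambda>t. \<Sum>k\<in>K. n k * f k t)"
proof -
  have *: "(\<Sum>t\<in>T. (\<Sum>k\<in>K. n k * f k t) * of_bool (g t = c))
    = (\<Sum>k\<in>K. n k * (\<Sum>t\<in>T. f k t * of_bool (g t = c)))" for g and c
    unfolding sum_distrib_left sum_distrib_right mult.assoc by (rule sum.swap)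
  show ?thesis
    unfolding balanced_def *
    using assms by (intro allI sum.cong) (auto simp: balanced_def)
qed

lemma balanced_diff:
  assumes "balanced T src tgt f" "balanced T src tgt g" "\<And>t. t \<in> T \<Longrightarrow> g t \<le> f t"
  shows "balanced T src tgt (\<lambda>t. f t - g t)"
proof -
  have *: "(\<Sum>t\<in>T. (f t - g t) * of_bool (h t = c))
    = (\<Sum>t\<in>T. f t * of_bool (h t = c)) - (\<Sum>t\<in>T. g t * of_bool (h t = c))" for h :: "'a \<Rightarrow> 'b" and c
    unfolding diff_mult_distrib using assms(3) by (intro sum_subtractf_nat) auto
  show ?thesis using assms(1,2) unfolding balanced_def * by simp
qed

text \<open>A minimal nonempty set of states closed under a choice of outgoing support edges is permuted by
  that choice.\<close>

lemma circulation_exists: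
  fixes src tgt :: "'e \<Rightarrow> 'v"
  assumes fin: "finite T" and bal: "balanced T src tgt f" and t0: "t0 \<in> T" "f t0 > 0"
  shows "\<exists>C \<in> circulations T src tgt. C \<noteq> {} \<and> (\<forall>t\<in>C. f t > 0)"
proof -
  define S where "S = {t\<in>T. f t > 0}"
  have S: "finite S" "S \<subseteq> T" "t0 \<in> S" using fin t0 by (auto simp: S_def)
  define W where "W = src ` S"
  have "\<exists>t\<in>S. src t = w" if "w \<in> W" for w using that by (auto simp: W_def)
  then obtain e where e: "\<And>w. w \<in> W \<Longrightarrow> e w \<in> S" "\<And>w. w \<in> W \<Longrightarrow> src (e w) = w" by metis
  \<comment> \<open>Positive inflow at \<open>tgt t\<close> forces positive outflow there by
    balance.\<close>
  have tgtW: "tgt t \<in> W" if "t \<in> S" for t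
  proof -
    have tT: "t \<in> T" "f t > 0" using that by (auto simp: S_def)
    have "0 < f t * of_bool (tgt t = tgt t)" using tT by simp
    also have "\<dots> \<le> (\<Sum>t'\<in>T. f t' * of_bool (tgt t' = tgt t))"
      using tT fin by (intro member_le_sum) auto
    also have "\<dots> = (\<Sum>t'\<in>T. f t' * of_bool (src t' = tgt t))"
      using bal by (simp add: balanced_def)
    finally have "(\<Sum>t'\<in>T. f t' * of_bool (src t' = tgt t)) \<noteq> 0" by simp
    then obtain t' where "t' \<in> T" "f t' * of_bool (src t' = tgt t) \<noteq> 0"
      by (rule sum.not_neutral_contains_not_neutral)
    then show ?thesis by (force simp: W_def S_def)
  qed
  define g where "g w = tgt (e w)" for w
  define closed where "closed P \<longleftrightarrow> P \<noteq> {} \<and> g ` P \<subseteq> P" for P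
  have finW: "finite W" using S by (simp add: W_def)
  have "closed W" using S e tgtW by (auto simp: closed_def g_def W_def)
  then obtain P where P: "P \<subseteq> W" "closed P" "\<And>P'. P' \<subset> P \<Longrightarrow> \<not> closed P'"
    using minimal_subset_exists[of W closed] finW by blast
  have finP: "finite P" using P finW finite_subset by blast
  have "closed (g ` P)" using P(2) by (auto simp: closed_def)
  \<comment> \<open>The image of a closed set is closed and contained in it, so minimality gives
    equality; a surjection of a finite set onto itself is injective.\<close>
  then have gP: "g ` P = P" using P(2,3) by (metis closed_def psubsetI)
  then have injg: "inj_on g P" using finP by (simp add: eq_card_imp_inj_on)
  define C where "C = e ` P"
  have inje: "inj_on e P" using e P by (metis inj_onI subsetD)
  have CS: "C \<subseteq> S" using e P by (auto simp: C_def)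
  \<comment> \<open>If an endpoint map composed with \<open>e\<close> permutes \<open>P\<close>,
    then every vertex of \<open>P\<close> is met by exactly one edge of \<open>C\<close>. This is
    used for both sources and targets.\<close>
  have sumC: "(\<Sum>t\<in>T. of_bool (t \<in> C) * of_bool (h t = c)) = (of_bool (c \<in> P) :: nat)"
    if h: "inj_on (\<lambda>w. h (e w)) P" "(\<lambda>w. h (e w)) ` P = P" for h c
  proof -
    have "(\<Sum>t\<in>T. of_bool (t \<in> C) * of_bool (h t = c)) = (\<Sum>t\<in>C. of_bool (h t = c) :: nat)"
      using CS S fin by (intro sum.mono_neutral_cong_right) auto
    also have "\<dots> = (\<Sum>w\<in>P. of_bool (h (e w) = c))"
      unfolding C_def by (simp add: sum.reindex[OF inje])
    also have "\<dots> = (\<Sum>w\<in>(\<lambda>w. h (e w)) ` P. of_bool (w = c))"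
      by (simp add: sum.reindex[OF h(1)])
    also have "\<dots> = of_bool (c \<in> P)" using h(2) finP by (simp add: of_bool_def)
    finally show ?thesis .
  qed
  have srce: "src (e w) = w" if "w \<in> P" for w using that e P by blast
  have "inj_on (\<lambda>w. src (e w)) P" "(\<lambda>w. src (e w)) ` P = P"
    using srce by (auto simp: inj_on_def)
  then have "balanced T src tgt (\<lambda>t. of_bool (t \<in> C))"
    unfolding balanced_def using sumC[of src] sumC[of tgt] injg gP by (simp add: g_def[abs_def])
  moreover have "card C \<le> card (src ` T)"
  proof -
    have "card C = card P" unfolding C_def by (rule card_image[OF inje])
    also have "\<dots> \<le> card (src ` T)" using P(1) S fin by (intro card_mono) (auto simp: W_def)
    finally show ?thesis .
  qed
  moreover have "C \<noteq> {}" using P(2) by (auto simp: C_def closed_def)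
  ultimately show ?thesis using CS S by (auto simp: circulations_def S_def)
qed

lemma finite_circulations: "finite T \<Longrightarrow> finite (circulations T src tgt)"
  by (rule finite_subset[of _ "Pow T"]) (auto simp: circulations_def)

text \<open>A nonempty circulation inside the support can be subtracted once without leaving the
  naturals, which lowers the total flow.\<close>

lemma balanced_decomposition:
  assumes fin: "finite T" and "balanced T src tgt f"
  shows "\<exists>n. \<forall>t\<in>T. f t = (\<Sum>C\<in>circulations T src tgt. n C * of_bool (t \<in> C))"
  using assms(2)
proof (induction "\<Sum>t\<in>T. f t" arbitrary: f rule: less_induct)
  case less
  show ?case
  proof (cases "\<exists>t\<in>T. f t > 0")
    case False
    then show ?thesis by (intro exI[of _ "\<lambda>_. 0"]) auto
  next
    case True
    then obtain D where D: "D \<in> circulations T src tgt" "D \<noteq> {}" "\<forall>t\<in>D. f t > 0"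
      using circulation_exists[OF fin less.prems] by blast
    define f' where "f' t = f t - of_bool (t \<in> D)" for t
    have DT: "D \<subseteq> T" using D by (simp add: circulations_def)
    have f: "f t = f' t + of_bool (t \<in> D)" for t using D(3) by (auto simp: f'_def)
    have "balanced T src tgt f'"
      unfolding f'_def using D f by (intro balanced_diff less.prems) (auto simp: circulations_def)
    moreover have "(\<Sum>t\<in>T. f' t) < (\<Sum>t\<in>T. f t)"
    proof -
      obtain t where "t \<in> D" using D by blast
      then show ?thesis
        using DT fin f by (intro sum_strict_mono_ex1) auto
    qed
    ultimately obtain n where n: "\<forall>t\<in>T. f' t = (\<Sum>C\<in>circulations T src tgt. n C * of_bool (t \<in> C))"
      using less.hyps by blast
    have "f t = (\<Sum>C\<in>circulations T src tgt. (n C + of_bool (C = D)) * of_bool (t \<in> C))"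
      if "t \<in> T" for t
    proof -
      have "(\<Sum>C\<in>circulations T src tgt. (n C + of_bool (C = D)) * of_bool (t \<in> C))
        = f' t + (\<Sum>C\<in>circulations T src tgt. if C = D then of_bool (t \<in> D) else 0)"
        using n that by (auto simp: distrib_right sum.distrib intro!: sum.cong sum.neutral)
      also have "\<dots> = f t" using D(1) finite_circulations[OF fin, of src tgt] f[of t] by (simp add: sum.delta)
      finally show ?thesis by simp
    qed
    then show ?thesis by (intro exI[of _ "\<lambda>C. n C + of_bool (C = D)"] ballI)
  qed
qed

text \<open>The unknowns are the multiplicities of the circulations, and the coefficient of
  \<open>C\<close> in row \<open>i\<close> is its displacement, at most \<open>q * a\<close> because
  \<open>C\<close> has at most \<open>q\<close> edges. The decomposition of \<open>f\<close>
  supplies the solution that \<open>small_solution\<close> shrinks.\<close>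

lemma small_balanced:
  fixes lab :: "'i \<Rightarrow> 'e \<Rightarrow> int" and src tgt :: "'e \<Rightarrow> 'v"
  assumes fin: "finite T" "finite I" and I: "card I \<ge> 1"
    and bal: "balanced T src tgt f" and t0: "t0 \<in> T" "f t0 \<ge> 1"
    and disp: "\<And>i. i \<in> I \<Longrightarrow> (\<Sum>t\<in>T. lab i t * int (f t)) = 0"
    and bound: "\<And>i t. i \<in> I \<Longrightarrow> t \<in> T \<Longrightarrow> \<bar>lab i t\<bar> \<le> int a" and a: "a \<ge> 1"
    and q: "card (src ` T) \<le> q"
  shows "\<exists>h. balanced T src tgt h \<and> h t0 \<ge> 1 \<and> (\<forall>i\<in>I. (\<Sum>t\<in>T. lab i t * int (h t)) = 0) \<and>
           (\<forall>t\<in>T. h t \<le> (2 * (q * a) + 1) ^ (card I)\<^sup>2)"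
proof -
  define J where "J = circulations T src tgt"
  have finJ: "finite J" unfolding J_def by (rule finite_circulations[OF fin(1)])
  define m where "m i C = (\<Sum>t\<in>T. lab i t * of_bool (t \<in> C))" for i and C :: "'e set"
  have swap: "(\<Sum>t\<in>T. lab i t * int (\<Sum>C\<in>J. n C * of_bool (t \<in> C))) = (\<Sum>C\<in>J. m i C * int (n C))" for n i
  proof -
    have "(\<Sum>t\<in>T. lab i t * int (\<Sum>C\<in>J. n C * of_bool (t \<in> C)))
      = (\<Sum>t\<in>T. \<Sum>C\<in>J. lab i t * of_bool (t \<in> C) * int (n C))"
      by (simp add: sum_distrib_left mult_ac)
    also have "\<dots> = (\<Sum>C\<in>J. m i C * int (n C))"
      unfolding m_def sum_distrib_right by (rule sum.swap)
    finally show ?thesis .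
  qed
  obtain n where n: "\<And>t. t \<in> T \<Longrightarrow> f t = (\<Sum>C\<in>J. n C * of_bool (t \<in> C))"
    using balanced_decomposition[OF fin(1) bal] unfolding J_def by blast
  \<comment> \<open>Some circulation through \<open>t0\<close> occurs in \<open>f\<close>;
    prescribing its index keeps \<open>t0\<close> in the support of the small solution.\<close>
  have "(\<Sum>C\<in>J. n C * of_bool (t0 \<in> C)) \<noteq> 0" using n t0 by (metis not_one_le_zero)
  then obtain C0 where "C0 \<in> J" "n C0 * of_bool (t0 \<in> C0) \<noteq> 0"
    by (rule sum.not_neutral_contains_not_neutral)
  then have C0: "C0 \<in> J" "t0 \<in> C0" "n C0 \<ge> 1" by auto
  have mbound: "\<bar>m i C\<bar> \<le> int (q * a)" if "i \<in> I" "C \<in> J" for i C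
  proof -
    have C: "C \<subseteq> T" "card C \<le> q" using that q by (auto simp: J_def circulations_def)
    have "m i C = (\<Sum>t\<in>C. lab i t)"
      unfolding m_def using C fin by (intro sum.mono_neutral_cong_right) auto
    also have "\<bar>\<dots>\<bar> \<le> (\<Sum>t\<in>C. \<bar>lab i t\<bar>)" by (rule sum_abs)
    also have "\<dots> \<le> (\<Sum>t\<in>C. int a)" using C bound that by (intro sum_mono) auto
    also have "\<dots> \<le> int (q * a)" using C by (simp add: mult_right_mono)
    finally show ?thesis .
  qed
  have kern: "(\<Sum>C\<in>J. m i C * int (n C)) = 0" if "i \<in> I" for i
    using disp[OF that] n unfolding swap[symmetric] by (simp cong: sum.cong)
  have "card (src ` T) \<ge> 1" using fin t0 by (auto simp: Suc_le_eq card_gt_0_iff)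
  then have "q * a \<ge> 1" using q a by simp
  then obtain y where y: "y C0 \<ge> 1" "\<And>i. i \<in> I \<Longrightarrow> (\<Sum>C\<in>J. m i C * int (y C)) = 0"
    "(\<Sum>C\<in>J. y C) \<le> (2 * (q * a) + 1) ^ (card I)\<^sup>2"
    using small_solution[of I J C0 "q * a" m n] fin(2) finJ I C0 mbound kern by blast
  define h where "h t = (\<Sum>C\<in>J. y C * of_bool (t \<in> C))" for t
  have "balanced T src tgt h"
    unfolding h_def by (rule balanced_sum) (simp add: J_def circulations_def)
  moreover have "h t0 \<ge> 1"
  proof -
    have "y C0 * of_bool (t0 \<in> C0) \<le> h t0"
      unfolding h_def using C0 finJ by (intro member_le_sum) auto
    then show ?thesis using y(1) C0 by simp
  qed
  moreover have "(\<Sum>t\<in>T. lab i t * int (h t)) = 0" if "i \<in> I" for i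
    using y(2)[OF that] swap unfolding h_def by simp
  \<comment> \<open>An edge is counted at most once per circulation, so the sum of the
    multiplicities bounds every value of \<open>h\<close>.\<close>
  moreover have "h t \<le> (2 * (q * a) + 1) ^ (card I)\<^sup>2" for t
  proof -
    have "h t \<le> (\<Sum>C\<in>J. y C)" unfolding h_def by (intro sum_mono) auto
    then show ?thesis using y(3) by linarith
  qed
  ultimately show ?thesis by blast
qed

section \<open>Witness graphs\<close>

lemma abs_le_vas_norm:
  assumes "is_vas d A" "a \<in> A" "i < d"
  shows "\<bar>a $ i\<bar> \<le> int (vas_norm d A)"
proof -
  have "{nat \<bar>a $ i\<bar> | a i. a \<in> A \<and> i < d} = (\<lambda>(a, i). nat \<bar>a $ i\<bar>) ` (A \<times> {..<d})" by auto
  then have "finite {nat \<bar>a $ i\<bar> | a i. a \<in> A \<and> i < d}" using assms by (simp add: is_vas_def)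
  then have "nat \<bar>a $ i\<bar> \<le> vas_norm d A"
    unfolding vas_norm_def using assms by (intro Max_ge) auto
  then show ?thesis by simp
qed

lemma card_vas_le:
  assumes "is_vas d A"
  shows "card A \<le> (1 + 2 * vas_norm d A) ^ d"
proof -
  let ?N = "int (vas_norm d A)"
  let ?F = "{..<d} \<rightarrow>\<^sub>E {- ?N..?N}"
  let ?f = "\<lambda>a. \<lambda>i\<in>{..<d}. a $ i"
  have A: "dim_vec a = d" if "a \<in> A" for a using assms that by (auto simp: is_vas_def)
  have "inj_on ?f A"
  proof (rule inj_onI)
    fix a b assume ab: "a \<in> A" "b \<in> A" "?f a = ?f b"
    have "a $ i = b $ i" if "i < d" for i using fun_cong[OF ab(3), of i] that by simp
    then show "a = b" using A[OF ab(1)] A[OF ab(2)] by (intro eq_vecI) auto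
  qed
  moreover have "?f ` A \<subseteq> ?F"
  proof (rule image_subsetI)
    fix a assume "a \<in> A"
    then have "- ?N \<le> a $ i \<and> a $ i \<le> ?N" if "i < d" for i
      using abs_le_vas_norm[OF assms _ that] by (simp add: abs_le_iff minus_le_iff)
    then show "?f a \<in> ?F" by auto
  qed
  moreover have "finite ?F" by (intro finite_PiE) auto
  ultimately have "card A \<le> card ?F" by (rule card_inj_on_le)
  also have "card ?F = (1 + 2 * vas_norm d A) ^ d"
  proof -
    have "nat (?N - (- ?N) + 1) = 1 + 2 * vas_norm d A" by simp
    then show ?thesis by (simp add: card_PiE)
  qed
  finally show ?thesis .
qed

section \<open>Transitions read coordinate by coordinate\<close>

lemma dim_star_vecs: "x \<in> star_vecs d I \<Longrightarrow> dim_vec x = d"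
  unfolding star_vecs_def by (blast intro: carrier_vecD)

lemma star_vecs_None_iff: "x \<in> star_vecs d I \<Longrightarrow> i < d \<Longrightarrow> x $ i = None \<longleftrightarrow> i \<in> I"
  unfolding star_vecs_def by blast

lemma star_step_component:
  assumes "I \<subseteq> {..<d}" "x \<in> star_vecs d I" "y \<in> star_vecs d I" "a \<in> carrier_vec d" "i < d"
    and step: "map_vec (map_option int) y =
      star_plus_vec (map_vec (map_option int) x) (star_proj I a)"
  shows "map_option int (y $ i) = star_plus (map_option int (x $ i)) (if i \<in> I then None else Some (a $ i))"
proof -
  have dim: "dim_vec x = d" "dim_vec y = d" "dim_vec a = d"
    using dim_star_vecs assms(2-4) by (metis, metis, auto)
  then have "map_vec (map_option int) y $ i = map_option int (y $ i)" using assms(5) by simp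
  moreover have "star_plus_vec (map_vec (map_option int) x) (star_proj I a) $ i
    = star_plus (map_option int (x $ i)) (if i \<in> I then None else Some (a $ i))"
    using dim assms(5) by (simp add: star_plus_vec_def star_proj_def)
  ultimately show ?thesis using step by simp
qed

lemma map_option_int_eq: "map_option int u = map_option int v \<Longrightarrow> u = v"
  by (cases u; cases v) auto

lemma subreachability_graphE:
  assumes "subreachability_graph d A Q T"
  obtains I where "I \<subseteq> {..<d}" "Q \<subseteq> star_vecs d I" "T \<subseteq> Q \<times> A \<times> Q"
    "\<And>x a y. (x, a, y) \<in> T \<Longrightarrow> map_vec (map_option int) y =
             star_plus_vec (map_vec (map_option int) x) (star_proj I a)"
proof -
  obtain I where I: "I \<subseteq> {..<d}" "Q \<subseteq> star_vecs d I" "T \<subseteq> Q \<times> A \<times> Q"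
    and step: "\<forall>(x, a, y) \<in> T. map_vec (map_option int) y =
             star_plus_vec (map_vec (map_option int) x) (star_proj I a)"
    using assms unfolding subreachability_graph_def by (elim exE conjE)
  show thesis using bspec[OF step] by (intro that[OF I]) fastforce
qed

text \<open>Both targets carry \<open>None\<close> on \<open>I\<close>, and elsewhere the source and
  the action fix the coordinate. This lets transitions be counted by source and label.\<close>

lemma subreachability_graph_deterministic:
  assumes "is_vas d A" "subreachability_graph d A Q T" "(x, a, y) \<in> T" "(x, a, y') \<in> T"
  shows "y = y'"
proof -
  obtain I where I: "I \<subseteq> {..<d}" "Q \<subseteq> star_vecs d I" "T \<subseteq> Q \<times> A \<times> Q"
    "\<And>x a y. (x, a, y) \<in> T \<Longrightarrow> map_vec (map_option int) y =
             star_plus_vec (map_vec (map_option int) x) (star_proj I a)"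
    using assms(2) by (rule subreachability_graphE) (rule that; simp)
  have mem: "x \<in> star_vecs d I" "y \<in> star_vecs d I" "y' \<in> star_vecs d I" "a \<in> carrier_vec d"
    using I assms by (auto simp: is_vas_def)
  show ?thesis
  proof (rule eq_vecI)
    fix i assume "i < dim_vec y'"
    then have "i < d" using dim_star_vecs mem by metis
    then show "y $ i = y' $ i"
      using star_step_component[OF I(1) mem(1,2,4) _ I(4)[OF assms(3)]]
        star_step_component[OF I(1) mem(1,3,4) _ I(4)[OF assms(4)]]
      by (intro map_option_int_eq) simp
  qed (use dim_star_vecs mem in metis)
qed

text \<open>Serves the degenerate case of norm zero, where \<open>small_balanced\<close> does not
  apply because it asks for \<open>a \<ge> 1\<close>.\<close>

lemma subreachability_graph_zero_norm:
  assumes "is_vas d A" "subreachability_graph d A Q T" "vas_norm d A = 0" "(x, a, y) \<in> T"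
  shows "x = y" and "a = 0\<^sub>v d"
proof -
  obtain I where I: "I \<subseteq> {..<d}" "Q \<subseteq> star_vecs d I" "T \<subseteq> Q \<times> A \<times> Q"
    "\<And>x a y. (x, a, y) \<in> T \<Longrightarrow> map_vec (map_option int) y =
             star_plus_vec (map_vec (map_option int) x) (star_proj I a)"
    using assms(2) by (rule subreachability_graphE) (rule that; simp)
  have mem: "x \<in> star_vecs d I" "y \<in> star_vecs d I" "a \<in> carrier_vec d" "a \<in> A"
    using I assms by (auto simp: is_vas_def)
  have a0: "a $ i = 0" if "i < d" for i
    using abs_le_vas_norm[OF assms(1) mem(4) that] assms(3) by simp
  show "a = 0\<^sub>v d" using a0 mem by (intro eq_vecI) auto
  show "x = y"
  proof (rule eq_vecI)
    fix i assume "i < dim_vec y"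
    then have i: "i < d" using dim_star_vecs mem by metis
    have none: "x $ i = None \<longleftrightarrow> i \<in> I" by (rule star_vecs_None_iff[OF mem(1) i])
    note step = star_step_component[OF I(1) mem(1,2,3) i I(4)[OF assms(4)]]
    show "x $ i = y $ i"
    proof (cases "x $ i")
      case None
      then show ?thesis using step by (simp add: star_plus_def)
    next
      case (Some k)
      then have "map_option int (y $ i) = map_option int (x $ i)"
        using step none a0[OF i] by (simp add: star_plus_def)
      then show ?thesis using map_option_int_eq by metis
    qed
  qed (use dim_star_vecs mem in metis)
qed

section \<open>From paths to Kirchhoff functions\<close>

abbreviation source :: "transition \<Rightarrow> state" where "source \<equiv> fst"
abbreviation target :: "transition \<Rightarrow> state" where "target t \<equiv> snd (snd t)"
abbreviation label :: "transition \<Rightarrow> int vec" where "label t \<equiv> fst (snd t)"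

lemma kirchhoff_if_balanced:
  assumes "finite T" "balanced T source target \<mu>"
  shows "kirchhoff Q T \<mu>"
proof -
  have "(\<Sum>t \<in> {(x, a, y) \<in> T. y = c}. \<mu> t) = (\<Sum>t\<in>T. \<mu> t * of_bool (target t = c))"
    "(\<Sum>t \<in> {(x, a, y) \<in> T. x = c}. \<mu> t) = (\<Sum>t\<in>T. \<mu> t * of_bool (source t = c))" for c
    using assms(1) by (intro sum.mono_neutral_cong_left; auto)+
  then show ?thesis using assms(2) by (simp add: kirchhoff_def balanced_def)
qed

lemma kirchhoff_displacement_eq_0_iff:
  assumes "finite T" "\<And>t. t \<in> T \<Longrightarrow> label t \<in> carrier_vec d"
  shows "kirchhoff_displacement d T \<mu> = 0\<^sub>v d \<longleftrightarrow>
    (\<forall>i<d. (\<Sum>t\<in>T. label t $ i * int (\<mu> t)) = 0)"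
proof -
  let ?f = "\<lambda>t. case t of (x, a, y) \<Rightarrow> int (\<mu> t) \<cdot>\<^sub>v a"
  have f: "?f \<in> T \<rightarrow> carrier_vec d" using assms(2) by auto
  have comp: "kirchhoff_displacement d T \<mu> $ i = (\<Sum>t\<in>T. label t $ i * int (\<mu> t))" if "i < d" for i
  proof -
    have "kirchhoff_displacement d T \<mu> $ i = (\<Sum>t\<in>T. ?f t $ i)"
      unfolding kirchhoff_displacement_def by (rule index_finsum_vec[OF assms(1) that f])
    also have "\<dots> = (\<Sum>t\<in>T. label t $ i * int (\<mu> t))"
    proof (rule sum.cong)
      fix t assume "t \<in> T"
      then have "dim_vec (label t) = d" by (intro carrier_vecD assms(2))
      then show "?f t $ i = label t $ i * int (\<mu> t)" using that by (cases t) simp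
    qed simp
    finally show ?thesis .
  qed
  have "kirchhoff_displacement d T \<mu> \<in> carrier_vec d"
    unfolding kirchhoff_displacement_def by (rule finsum_vec_closed[OF f])
  then show ?thesis using comp by (auto simp: vec_eq_iff)
qed

lemma dim_word_displacement [simp]: "dim_vec (word_displacement d \<sigma>) = d"
  unfolding word_displacement_def by (induction \<sigma>) auto

lemma word_displacement_Cons: "word_displacement d (a # \<sigma>) = a + word_displacement d \<sigma>"
  by (simp add: word_displacement_def)

lemma sum_of_bool_eq_mult:
  fixes h :: "'a \<Rightarrow> 'b::semiring_1"
  assumes "finite T" "e \<in> T"
  shows "(\<Sum>t\<in>T. of_bool (t = e) * h t) = h e"
proof -
  have "(\<Sum>t\<in>T. of_bool (t = e) * h t) = (\<Sum>t\<in>T. if t = e then h e else 0)"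
    by (intro sum.cong) auto
  then show ?thesis using assms by simp
qed

text \<open>The function \<open>f\<close> counts how often a path uses each transition. The
  indicators of the endpoints are added on opposite sides to avoid subtraction of naturals.\<close>

lemma graph_path_flow:
  assumes "graph_path Q T x \<sigma> y" "finite T"
  shows "\<exists>f. (\<forall>c. (\<Sum>t\<in>T. f t * of_bool (target t = c)) + of_bool (x = c)
                = (\<Sum>t\<in>T. f t * of_bool (source t = c)) + of_bool (y = c)) \<and>
             (\<forall>i<d. (\<Sum>t\<in>T. label t $ i * int (f t)) = word_displacement d \<sigma> $ i)"
  using assms(1)
proof induction
  case (graph_path_Nil x)
  show ?case by (intro exI[of _ "\<lambda>_. 0"]) (simp add: word_displacement_def)
next
  case (graph_path_Cons x a y \<sigma> z)
  then obtain f where f: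
    "\<And>c. (\<Sum>t\<in>T. f t * of_bool (target t = c)) + of_bool (y = c)
       = (\<Sum>t\<in>T. f t * of_bool (source t = c)) + of_bool (z = c)"
    "\<And>i. i < d \<Longrightarrow> (\<Sum>t\<in>T. label t $ i * int (f t)) = word_displacement d \<sigma> $ i"
    by blast
  let ?e = "(x, a, y)"
  define f' where "f' t = f t + of_bool (t = ?e)" for t
  have e: "(\<Sum>t\<in>T. of_bool (t = ?e) * h t) = h ?e" for h :: "transition \<Rightarrow> 'b::semiring_1"
    using assms(2) graph_path_Cons.hyps(1) by (rule sum_of_bool_eq_mult)
  have split: "(\<Sum>t\<in>T. f' t * of_bool (h t = c)) = (\<Sum>t\<in>T. f t * of_bool (h t = c)) + of_bool (h ?e = c)"
    for h :: "transition \<Rightarrow> state" and c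
    using e[of "\<lambda>t. of_bool (h t = c) :: nat"] by (simp add: f'_def distrib_right sum.distrib)
  have "(\<Sum>t\<in>T. f' t * of_bool (target t = c)) + of_bool (x = c)
      = (\<Sum>t\<in>T. f' t * of_bool (source t = c)) + of_bool (z = c)" for c
    unfolding split using f(1)[of c] by simp
  moreover have "(\<Sum>t\<in>T. label t $ i * int (f' t)) = word_displacement d (a # \<sigma>) $ i" if "i < d" for i
  proof -
    have "(\<Sum>t\<in>T. label t $ i * int (f' t))
      = (\<Sum>t\<in>T. label t $ i * int (f t)) + (\<Sum>t\<in>T. of_bool (t = ?e) * label t $ i)"
      by (simp add: f'_def distrib_left sum.distrib mult.commute)
    then show ?thesis using f(2)[OF that] e[of "\<lambda>t. label t $ i"] that
      by (simp add: word_displacement_Cons)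
  qed
  ultimately show ?case by blast
qed

text \<open>Reversibility closes the single step \<open>t\<close> by a return path of opposite
  displacement. Counting the transitions of this closed walk gives a balanced function with zero
  displacement that uses \<open>t\<close>.\<close>

lemma reversible_zero_circulation:
  assumes "reversible d Q T" "finite T" "t \<in> T" "target t \<in> Q" "label t \<in> carrier_vec d"
  shows "\<exists>f. balanced T source target f \<and> f t \<ge> 1 \<and>
             (\<forall>i<d. (\<Sum>t\<in>T. label t $ i * int (f t)) = 0)"
proof -
  obtain x a y where t: "t = (x, a, y)" by (cases t) auto
  have "graph_path Q T x [a] y" using assms t by (auto intro: graph_path.intros)
  then obtain v where v: "graph_path Q T y v x"
    "word_displacement d [a] + word_displacement d v = 0\<^sub>v d"
    using assms(1) unfolding reversible_def by blast
  obtain f where f: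
    "\<And>c. (\<Sum>t\<in>T. f t * of_bool (target t = c)) + of_bool (y = c)
       = (\<Sum>t\<in>T. f t * of_bool (source t = c)) + of_bool (x = c)"
    "\<And>i. i < d \<Longrightarrow> (\<Sum>t\<in>T. label t $ i * int (f t)) = word_displacement d v $ i"
    using graph_path_flow[OF v(1) assms(2), of d] by blast
  define f' where "f' s = f s + of_bool (s = t)" for s
  have e: "(\<Sum>s\<in>T. of_bool (s = t) * h s) = h t" for h :: "transition \<Rightarrow> 'b::semiring_1"
    using assms(2,3) by (rule sum_of_bool_eq_mult)
  have split: "(\<Sum>s\<in>T. f' s * of_bool (h s = c)) = (\<Sum>s\<in>T. f s * of_bool (h s = c)) + of_bool (h t = c)"
    for h :: "transition \<Rightarrow> state" and c
    using e[of "\<lambda>s. of_bool (h s = c) :: nat"] by (simp add: f'_def distrib_right sum.distrib)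
  have "balanced T source target f'"
    unfolding balanced_def split using f(1) by (simp add: t)
  moreover have "(\<Sum>s\<in>T. label s $ i * int (f' s)) = 0" if "i < d" for i
  proof -
    have "(\<Sum>s\<in>T. label s $ i * int (f' s))
      = (\<Sum>s\<in>T. label s $ i * int (f s)) + (\<Sum>s\<in>T. of_bool (s = t) * label s $ i)"
      by (simp add: f'_def distrib_left sum.distrib mult.commute)
    also have "\<dots> = word_displacement d v $ i + a $ i"
      using f(2)[OF that] e[of "\<lambda>s. label s $ i"] by (simp add: t)
    also have "\<dots> = (word_displacement d [a] + word_displacement d v) $ i"
      using that by (simp add: t word_displacement_Cons word_displacement_def[of d "[]"] add.commute)
    finally show ?thesis using v(2) that by simp
  qed
  ultimately show ?thesis by (intro exI[of _ f']) (simp add: f'_def)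
qed

lemma card_transitions_le:
  assumes "is_vas d A" "subreachability_graph d A Q T"
  shows "card T \<le> card Q * (1 + 2 * vas_norm d A) ^ d"
proof -
  have T: "T \<subseteq> Q \<times> A \<times> Q" "finite Q" "finite A"
    using assms by (auto simp: subreachability_graph_def is_vas_def)
  have "inj_on (\<lambda>(x, a, y). (x, a)) T"
    using subreachability_graph_deterministic[OF assms] by (auto simp: inj_on_def)
  then have "card T \<le> card (Q \<times> A)" using T by (intro card_inj_on_le) auto
  also have "\<dots> \<le> card Q * (1 + 2 * vas_norm d A) ^ d"
    using card_vas_le[OF assms(1)] by (simp add: card_cartesian_product)
  finally show ?thesis .
qed

section \<open>Summing the small functions into a total one\<close>

theorem theorem7p3:
  fixes d :: nat and A :: "int vec set" and Q :: "state set" and T :: "transition set"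
  assumes "is_vas d A"
    and "witness_graph d A Q T"
    and "reversible d Q T"
  shows "\<exists>\<mu>. total_kirchhoff Q T \<mu> \<and>
             kirchhoff_displacement d T \<mu> = 0\<^sub>v d \<and>
             kirchhoff_norm T \<mu> \<le> (card Q * (1 + 2 * vas_norm d A)) ^ (d * (d + 1))"
proof -
  define q where "q = card Q"
  define a where "a = vas_norm d A"
  define X where "X = q * (1 + 2 * a)"
  have G: "subreachability_graph d A Q T" using assms(2) by (simp add: witness_graph_def)
  then have Q: "finite Q" "Q \<noteq> {}" and T: "finite T" "T \<subseteq> Q \<times> A \<times> Q"
    by (auto simp: subreachability_graph_def)
  have q: "q \<ge> 1" using Q by (simp add: q_def Suc_le_eq card_gt_0_iff)
  have X: "X \<ge> 1" using q by (simp add: X_def)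
  have lab: "label t \<in> A" "label t \<in> carrier_vec d" "target t \<in> Q" if "t \<in> T" for t
  proof -
    have t: "t \<in> Q \<times> A \<times> Q" using that T(2) by blast
    then show "label t \<in> A" "target t \<in> Q" by auto
    then show "label t \<in> carrier_vec d" using assms(1) unfolding is_vas_def by blast
  qed
  have "\<exists>\<mu>. balanced T source target \<mu> \<and> (\<forall>t\<in>T. \<mu> t \<ge> 1) \<and>
     (\<forall>i<d. (\<Sum>t\<in>T. label t $ i * int (\<mu> t)) = 0) \<and> (\<forall>t\<in>T. \<mu> t \<le> X ^ (d * (d + 1)))"
  \<comment> \<open>With norm zero all transitions are loops labelled by zero, so the constant
    function \<open>1\<close> works. This case also absorbs \<open>d = 0\<close>.\<close>
  proof (cases "a = 0")
    case True
    have loop: "source t = target t" "label t = 0\<^sub>v d" if "t \<in> T" for t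
    proof -
      have "(source t, label t, target t) \<in> T" "vas_norm d A = 0" using that True by (simp_all add: a_def)
      then show "source t = target t" "label t = 0\<^sub>v d"
        using subreachability_graph_zero_norm[OF assms(1) G] by blast+
    qed
    have "balanced T source target (\<lambda>_. 1)" using loop(1) by (simp add: balanced_def)
    then show ?thesis using X loop(2) by (intro exI[of _ "\<lambda>_. 1"]) simp
  next
    case False
    moreover have "a = 0" if "d = 0" using that by (simp add: a_def vas_norm_def)
    ultimately have "d \<noteq> 0" by blast
    define good where "good t h \<longleftrightarrow> balanced T source target h \<and> h t \<ge> 1 \<and>
        (\<forall>i<d. (\<Sum>s\<in>T. label s $ i * int (h s)) = 0) \<and> (\<forall>s\<in>T. h s \<le> X ^ d\<^sup>2)" for t h
    have "\<exists>h. good t h" if t: "t \<in> T" for t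
    proof -
      obtain f where f: "balanced T source target f" "f t \<ge> 1"
        "\<forall>i<d. (\<Sum>t\<in>T. label t $ i * int (f t)) = 0"
        using reversible_zero_circulation[OF assms(3) T(1) t lab(3,2)[OF t]] by blast
      have "card (source ` T) \<le> q" unfolding q_def using Q T by (intro card_mono) auto
      moreover have "\<bar>label s $ i\<bar> \<le> int a" if "i < d" "s \<in> T" for i s
        using abs_le_vas_norm[OF assms(1) lab(1)] that by (simp add: a_def)
      ultimately obtain h where h: "balanced T source target h" "h t \<ge> 1"
        "\<forall>i<d. (\<Sum>s\<in>T. label s $ i * int (h s)) = 0" "\<forall>s\<in>T. h s \<le> (2 * (q * a) + 1) ^ d\<^sup>2"
        using small_balanced[of T "{..<d}" source target f t "\<lambda>i s. label s $ i" a q] f T t \<open>d \<noteq> 0\<close> False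
        by auto
      \<comment> \<open>The difference of the two sides is \<open>q - 1\<close>, and
        \<open>q \<ge> 1\<close> since there is a state.\<close>
      have "2 * (q * a) + 1 \<le> X" using q by (simp add: X_def algebra_simps)
      then have "(2 * (q * a) + 1) ^ d\<^sup>2 \<le> X ^ d\<^sup>2" by (rule power_mono) simp
      then have "good t h" using h unfolding good_def by (blast intro: order_trans)
      then show ?thesis by blast
    qed
    then obtain h where good: "\<And>t. t \<in> T \<Longrightarrow> good t (h t)" by metis
    then have h: "\<And>t. t \<in> T \<Longrightarrow> balanced T source target (h t)"
      "\<And>t. t \<in> T \<Longrightarrow> h t t \<ge> 1"
      "\<And>t i. t \<in> T \<Longrightarrow> i < d \<Longrightarrow> (\<Sum>s\<in>T. label s $ i * int (h t s)) = 0"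
      "\<And>t s. t \<in> T \<Longrightarrow> s \<in> T \<Longrightarrow> h t s \<le> X ^ d\<^sup>2"
      unfolding good_def by blast+
    \<comment> \<open>Totality comes from the diagonal summands: \<open>h s\<close> is positive at
      \<open>s\<close>.\<close>
    define \<mu> where "\<mu> s = (\<Sum>t\<in>T. h t s)" for s
    have "balanced T source target \<mu>"
      using balanced_sum[of T T source target h "\<lambda>_. 1"] h(1) by (simp add: \<mu>_def[abs_def])
    moreover have "\<mu> t \<ge> 1" if "t \<in> T" for t
    proof -
      have "h t t \<le> \<mu> t" unfolding \<mu>_def using that T by (intro member_le_sum) auto
      then show ?thesis using h(2)[OF that] by simp
    qed
    moreover have "(\<Sum>s\<in>T. label s $ i * int (\<mu> s)) = 0" if "i < d" for i
    proof -
      have "(\<Sum>s\<in>T. label s $ i * int (\<mu> s)) = (\<Sum>t\<in>T. \<Sum>s\<in>T. label s $ i * int (h t s))"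
        unfolding \<mu>_def of_nat_sum sum_distrib_left by (rule sum.swap)
      then show ?thesis using h(3)[OF _ that] by simp
    qed
    moreover have "\<mu> s \<le> X ^ (d * (d + 1))" if "s \<in> T" for s
    proof -
      have "\<mu> s \<le> card T * X ^ d\<^sup>2"
        unfolding \<mu>_def using sum_bounded_above[of T "\<lambda>t. h t s"] h(4) that by simp
      also have "card T \<le> q * (1 + 2 * a) ^ d"
        unfolding q_def a_def by (rule card_transitions_le[OF assms(1) G])
      \<comment> \<open>Raising \<open>q\<close> to the power \<open>d \<ge> 1\<close> turns the
        count of transitions into \<open>X ^ d\<close>, and \<open>d + d\<^sup>2\<close> is the
        exponent sought.\<close>
      also have "\<dots> \<le> q ^ d * (1 + 2 * a) ^ d"
        using q \<open>d \<noteq> 0\<close> by (intro mult_right_mono self_le_power) auto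
      also have "\<dots> = X ^ d" by (simp only: X_def power_mult_distrib)
      also have "X ^ d * X ^ d\<^sup>2 = X ^ (d * (d + 1))"
        by (simp add: power_add power2_eq_square distrib_left)
      finally show ?thesis by simp
    qed
    ultimately show ?thesis by blast
  qed
  then obtain \<mu> where \<mu>: "balanced T source target \<mu>" "\<forall>t\<in>T. \<mu> t \<ge> 1"
     "\<forall>i<d. (\<Sum>t\<in>T. label t $ i * int (\<mu> t)) = 0" "\<forall>t\<in>T. \<mu> t \<le> X ^ (d * (d + 1))"
    by blast
  have "total_kirchhoff Q T \<mu>"
    using \<mu>(2) kirchhoff_if_balanced[OF T(1) \<mu>(1)] by (simp add: total_kirchhoff_def)
  moreover have "kirchhoff_displacement d T \<mu> = 0\<^sub>v d"
    using kirchhoff_displacement_eq_0_iff[OF T(1) lab(2)] \<mu>(3) by simp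
  moreover have "kirchhoff_norm T \<mu> \<le> X ^ (d * (d + 1))"
    unfolding kirchhoff_norm_def using T \<mu>(4) by (subst Max_le_iff) auto
  ultimately show ?thesis unfolding X_def q_def a_def by blast
qed

end
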